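(* Let $X$ be a finite-dimensional real Hilbert space, let $T\colon X\to X$ be averaged, and let $v := P_{\overline{\operatorname{ran}}(\operatorname{Id}-T)}0$. Suppose that $\operatorname{Fix}(v+T)\neq\varnothing$ and that $\operatorname{codim}\operatorname{Fix}(v+T)\le 1$. Then for every $(x,y)\in X\times X$, the sequence $(T^nx-T^ny)_{n\in\mathbb{N}}$ is convergent.
   Context: A map $S\colon X\to X$ is nonexpansive if $\|Sx-Sy\|\le\|x-y\|$ for all $x,y\in X$. $T$ is averaged if there exist a nonexpansive $R\colon X\to X$ and $\alpha\in\left]0,1\right[$ such that $T=(1-\alpha)\operatorname{Id}+\alpha R$; such a $T$ is nonexpansive. For nonexpansive $T$, the set $\overline{\operatorname{ran}}(\operatorname{Id}-T)$ (the closure of the range of $\operatorname{Id}-T$) is known to be nonempty, closed and convex, so $v$, the projection of $0$ onto this set (its element of minimal norm), is well defined. $\operatorname{Fix}(v+T):=\{x\in X : x=v+Tx\}$, a closed convex set. For a nonempty closed convex set $C\subseteq X$, $\operatorname{codim}C:=\operatorname{codim}(\operatorname{aff}C-\operatorname{aff}C)$, the codimension in $X$ of the linear subspace parallel to the affine hull of $C$. *)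

theory Defs
  imports "HOL-Analysis.Analysis"
begin

definition nonexpansive :: "('a::real_normed_vector \<Rightarrow> 'a) \<Rightarrow> bool"
  where "nonexpansive S \<longleftrightarrow> (\<forall>x y. norm (S x - S y) \<le> norm (x - y))"

definition averaged :: "('a::real_normed_vector \<Rightarrow> 'a) \<Rightarrow> bool"
  where "averaged T \<longleftrightarrow>
    (\<exists>R \<alpha>. nonexpansive R \<and> 0 < \<alpha> \<and> \<alpha> < 1 \<and> T = (\<lambda>x. (1 - \<alpha>) *\<^sub>R x + \<alpha> *\<^sub>R R x))"

(* Unlike class euclidean_space, this admits the zero space.  Every such normed space is of class
   heine_borel, the class closest_point needs. *)
definition finite_dimensional :: "'a::real_vector itself \<Rightarrow> bool"
  where "finite_dimensional _ \<longleftrightarrow> (\<exists>B::'a set. finite B \<and> span B = UNIV)"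

(* Meant for nonempty C in a finite-dimensional space: dim is then the true dimension
   (it is 0 by convention without a finite basis), and the subtraction does not truncate,
   since aff C - aff C is a linear subspace. *)
definition codim :: "'a::real_vector set \<Rightarrow> nat"
  where "codim C = dim (UNIV :: 'a set) - dim {x - y | x y. x \<in> affine hull C \<and> y \<in> affine hull C}"

end

theory Submission
  imports Defs
begin

text \<open>
  For a fixed point \<open>f\<close> of \<open>v + T\<close> the orbit is \<open>T\<^sup>n f = f - n v\<close>, so the sequence
  \<open>z\<^sub>n = T\<^sup>n x + n v\<close> is Fejer monotone with respect to \<open>Fix (v + T)\<close>; averagedness also gives
  \<open>z\<^sub>n - z\<^sub>n\<^sub>+\<^sub>1 \<longlonglongrightarrow> 0\<close>.  Two cluster points of \<open>z\<close> have equal distance to every point of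
  \<open>Fix (v + T)\<close>, so they differ by a vector normal to its affine hull.  In codimension at most one
  the cluster points thus lie on one line and on one sphere, and there are at most two of them.
  A bounded sequence with vanishing steps cannot oscillate between two cluster points, hence \<open>z\<close>
  converges, and \<open>T\<^sup>n x - T\<^sup>n y\<close> is the difference of two such sequences.
\<close>

text \<open>By compactness all but finitely many terms lie in small balls around \<open>p\<close>
  and \<open>q\<close>, and short steps cannot carry the sequence from one ball to the other. The
  case \<open>p = q\<close> is allowed and covers a single cluster point.\<close>

lemma convergent_if_two_cluster_points:
  fixes z :: "nat \<Rightarrow> 'a::heine_borel"
  assumes bdd: "bounded (range z)"
    and step: "(\<lambda>n. dist (z n) (z (Suc n))) \<longlonglongrightarrow> 0"
    and cl: "\<And>l r. strict_mono r \<Longrightarrow> (z \<circ> r) \<longlonglongrightarrow> l \<Longrightarrow> l = p \<or> l = q"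
  shows "convergent z"
proof -
  have near: "eventually (\<lambda>n. dist (z n) p < e \<or> dist (z n) q < e) sequentially" if e: "e > 0" for e
  proof (rule ccontr)
    assume "\<not> ?thesis"
    then have "\<exists>\<^sub>F n in sequentially. dist (z n) p \<ge> e \<and> dist (z n) q \<ge> e"
      by (simp add: not_eventually not_less)
    then have inf: "infinite {n. dist (z n) p \<ge> e \<and> dist (z n) q \<ge> e}"
      by (simp add: frequently_cofinite flip: cofinite_eq_sequentially)
    then obtain s :: "nat \<Rightarrow> nat" where s: "strict_mono s"
        "\<And>n. s n \<in> {n. dist (z n) p \<ge> e \<and> dist (z n) q \<ge> e}"
      using infinite_enumerate by blast
    have "bounded (range (z \<circ> s))"
      using bdd by (rule bounded_subset) auto
    then obtain l r where r: "strict_mono r" "((z \<circ> s) \<circ> r) \<longlonglongrightarrow> l"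
      using bounded_imp_convergent_subsequence by blast
    then have "l = p \<or> l = q"
      using cl[of "s \<circ> r" l] s(1) by (simp add: strict_mono_o comp_assoc)
    moreover have "e \<le> dist l p" "e \<le> dist l q"
      using s(2) by (auto intro!: LIMSEQ_le_const[OF tendsto_dist[OF r(2) tendsto_const]])
    ultimately show False using e by auto
  qed
  show ?thesis
  proof (cases "p = q")
    case True
    then have "z \<longlonglongrightarrow> p" using near by (simp add: tendsto_iff)
    then show ?thesis by (rule convergentI)
  next
    case False
    \<comment> \<open>With this radius, passing from one ball to the other would give
      \<open>dist p q < e + e + e\<close>, since steps are eventually shorter than
      \<open>e\<close>.\<close>
    define e where "e = dist p q / 3"
    have e: "e > 0" using False by (simp add: e_def)
    have "eventually (\<lambda>n. dist (z n) (z (Suc n)) < e) sequentially"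
      using order_tendstoD(2)[OF step e] .
    with near[OF e] have "eventually (\<lambda>n. dist (z n) (z (Suc n)) < e \<and>
        (dist (z n) p < e \<or> dist (z n) q < e)) sequentially"
      by eventually_elim auto
    then obtain N where N: "\<And>n. n \<ge> N \<Longrightarrow> dist (z n) (z (Suc n)) < e"
        "\<And>n. n \<ge> N \<Longrightarrow> dist (z n) p < e \<or> dist (z n) q < e"
      unfolding eventually_sequentially by blast
    have stay: "z \<longlonglongrightarrow> a"
      if ab: "a = p \<and> b = q \<or> a = q \<and> b = p" and start: "dist (z N) a < e" for a b
    proof -
      have sep: "dist a b = 3 * e" using ab by (auto simp: e_def dist_commute)
      have in_a: "dist (z n) a < e" if "n \<ge> N" for n
        using that
      proof (induction n rule: dec_induct)
        case base
        show ?case by (rule start)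
      next
        case (step n)
        have "\<not> dist (z (Suc n)) b < e"
          using step.IH N(1)[OF step.hyps(1)] sep dist_triangle2[of a b "z n"]
            dist_triangle[of "z n" b "z (Suc n)"] dist_triangle[of a b "z n"]
          by (simp add: dist_commute)
        then show ?case using N(2)[of "Suc n"] step.hyps ab by auto
      qed
      have far_b: "\<not> dist (z n) b < e" if "n \<ge> N" for n
        using in_a[OF that] sep e dist_triangle[of a b "z n"] by (simp add: dist_commute)
      show ?thesis
        unfolding tendsto_iff
      proof (intro allI impI)
        fix d :: real assume "d > 0"
        then have "eventually (\<lambda>n. dist (z n) p < min d e \<or> dist (z n) q < min d e) sequentially"
          using near[of "min d e"] e by simp
        with eventually_ge_at_top[of N] show "eventually (\<lambda>n. dist (z n) a < d) sequentially"
          by eventually_elim (use far_b ab in auto)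
      qed
    qed
    from N(2)[of N] show ?thesis
      using stay convergentI by blast
  qed
qed

text \<open>With \<open>B\<close> a basis of the parallel space, \<open>w\<close> enlarges
  \<open>B\<close> to a basis of the whole space, because there is room for at most one more vector.
  So \<open>u\<close> lies in \<open>span (insert w B)\<close>, and its component along
  \<open>B\<close> vanishes by orthogonality.\<close>

lemma codim_le_1_normals_parallel:
  fixes C :: "'a::real_inner set"
  assumes fin: "finite_dimensional TYPE('a)"
    and codim: "codim C \<le> 1"
    and w: "w \<noteq> 0" "\<And>x y. x \<in> C \<Longrightarrow> y \<in> C \<Longrightarrow> w \<bullet> (x - y) = 0"
    and u: "\<And>x y. x \<in> C \<Longrightarrow> y \<in> C \<Longrightarrow> u \<bullet> (x - y) = 0"
  obtains k where "u = k *\<^sub>R w"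
proof -
  define W where "W = {x - y | x y. x \<in> affine hull C \<and> y \<in> affine hull C}"
  obtain B where B: "B \<subseteq> W" "independent B" "W \<subseteq> span B" "card B = dim W"
    using basis_exists by blast
  obtain U :: "'a set" where U: "independent U" "UNIV \<subseteq> span U" "card U = dim (UNIV :: 'a set)"
    using basis_exists by blast
  \<comment> \<open>Finite-dimensionality enters here: it makes \<open>U\<close> finite, so that
    \<open>dim UNIV\<close> bounds the size of independent sets.\<close>
  obtain A :: "'a set" where A: "finite A" "span A = UNIV"
    using fin unfolding finite_dimensional_def by blast
  have finU: "finite U" using independent_span_bound[OF A(1) U(1)] A by auto
  have bound: "finite S \<and> card S \<le> dim (UNIV :: 'a set)" if "independent S" for S :: "'a set"
    using independent_span_bound[OF finU that] U by auto
  have dimW: "dim (UNIV :: 'a set) \<le> card B + 1"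
    using codim B(4) unfolding codim_def W_def by linarith
  have orth: "n \<bullet> b = 0"
    if n: "\<And>x y. x \<in> C \<Longrightarrow> y \<in> C \<Longrightarrow> n \<bullet> (x - y) = 0" and b: "b \<in> span B" for n b
  proof -
    have hull: "n \<bullet> x = n \<bullet> c" if "x \<in> affine hull C" "c \<in> C" for x c
    proof -
      have "affine hull C \<subseteq> {x. n \<bullet> x = n \<bullet> c}"
        by (rule hull_minimal) (use n[OF _ that(2)] in \<open>auto simp: inner_diff_right affine_hyperplane\<close>)
      then show ?thesis using that by blast
    qed
    have "n \<bullet> x = 0" if x: "x \<in> W" for x
    proof -
      obtain y y' where y: "x = y - y'" "y \<in> affine hull C" "y' \<in> affine hull C"
        using x unfolding W_def by blast
      then obtain c where "c \<in> C" by fastforce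
      then show ?thesis using y hull by (simp add: inner_diff_right)
    qed
    then have "span B \<subseteq> {x. n \<bullet> x = 0}"
      by (intro span_minimal subspace_hyperplane) (use B(1) in auto)
    then show ?thesis using b by blast
  qed
  have wB: "w \<notin> span B" using orth[OF w(2), of w] w(1) by auto
  then have indw: "independent (insert w B)" using B(2) by (simp add: independent_insertI)
  have "u \<in> span (insert w B)"
  proof (rule ccontr)
    assume nu: "u \<notin> span (insert w B)"
    then have "independent (insert u (insert w B))" using indw by (rule independent_insertI)
    moreover have "w \<notin> B" "u \<notin> insert w B" using wB nu span_base by blast+
    ultimately show False using bound[of "insert u (insert w B)"] dimW by auto
  qed
  then obtain k where k: "u - k *\<^sub>R w \<in> span B" unfolding span_insert by blast
  \<comment> \<open>The vector lies in \<open>span B\<close> and is also orthogonal to it.\<close>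
  have "(u - k *\<^sub>R w) \<bullet> (u - k *\<^sub>R w) = 0"
    by (rule orth[OF _ k]) (simp add: inner_diff_left u w(2))
  then show ?thesis by (intro that[of k]) simp
qed

text \<open>This is the identity for the squared norm of a convex combination of
  \<open>a = x - y\<close> and \<open>b = R x - R y\<close>. The displacements differ by
  \<open>\<alpha> *\<^sub>R (a - b)\<close>, which yields the constant
  \<open>(1 - \<alpha>) / \<alpha>\<close>.\<close>

lemma averaged_strict_contraction:
  fixes T :: "'a::real_inner \<Rightarrow> 'a"
  assumes "averaged T"
  obtains c where "c > 0"
    "\<And>x y. (norm (T x - T y))\<^sup>2 \<le> (norm (x - y))\<^sup>2 - c * (norm ((x - T x) - (y - T y)))\<^sup>2"
proof -
  obtain R \<alpha> where R: "nonexpansive R" "0 < \<alpha>" "\<alpha> < 1"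
      "T = (\<lambda>x. (1 - \<alpha>) *\<^sub>R x + \<alpha> *\<^sub>R R x)"
    using assms unfolding averaged_def by blast
  show ?thesis
  proof (rule that)
    show "(1 - \<alpha>) / \<alpha> > 0" using R by simp
    fix x y :: 'a
    define a where "a = x - y"
    define b where "b = R x - R y"
    have T: "T x - T y = (1 - \<alpha>) *\<^sub>R a + \<alpha> *\<^sub>R b"
      "(x - T x) - (y - T y) = \<alpha> *\<^sub>R (a - b)"
      by (simp_all add: R(4) a_def b_def algebra_simps)
    have "(norm b)\<^sup>2 \<le> (norm a)\<^sup>2"
      using R(1) by (intro power_mono) (auto simp: nonexpansive_def a_def b_def)
    then have "\<alpha> * (b \<bullet> b) \<le> \<alpha> * (a \<bullet> a)"
      using R(2) by (simp add: power2_norm_eq_inner)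
    moreover have "(norm ((1 - \<alpha>) *\<^sub>R a + \<alpha> *\<^sub>R b))\<^sup>2
        = (1 - \<alpha>) * (a \<bullet> a) + \<alpha> * (b \<bullet> b) - \<alpha> * (1 - \<alpha>) * ((a - b) \<bullet> (a - b))"
      unfolding power2_norm_eq_inner inner_add_left inner_add_right inner_diff_left
        inner_diff_right inner_scaleR_left inner_scaleR_right inner_commute[of b a]
      by (simp add: algebra_simps)
    moreover have "(1 - \<alpha>) * (a \<bullet> a) = (norm a)\<^sup>2 - \<alpha> * (a \<bullet> a)"
      by (simp add: power2_norm_eq_inner left_diff_distrib)
    moreover have "(1 - \<alpha>) / \<alpha> * (norm (\<alpha> *\<^sub>R (a - b)))\<^sup>2 = \<alpha> * (1 - \<alpha>) * ((a - b) \<bullet> (a - b))"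
      using R(2) by (simp add: power_mult_distrib power2_norm_eq_inner[symmetric] power2_eq_square)
    ultimately show "(norm (T x - T y))\<^sup>2
        \<le> (norm (x - y))\<^sup>2 - (1 - \<alpha>) / \<alpha> * (norm ((x - T x) - (y - T y)))\<^sup>2"
      unfolding T a_def[symmetric] by linarith
  qed
qed

lemma decreasing_nonneg_diff_tendsto_0:
  fixes a :: "nat \<Rightarrow> real"
  assumes "decseq a" "\<And>n. a n \<ge> 0"
  shows "(\<lambda>n. a n - a (Suc n)) \<longlonglongrightarrow> 0"
proof -
  obtain L where L: "a \<longlonglongrightarrow> L" using decseq_convergent[of a 0] assms by metis
  then show ?thesis using tendsto_diff[OF L LIMSEQ_Suc[OF L]] by simp
qed

text \<open>The orbit itself may drift to infinity; adding \<open>real n *\<^sub>R v\<close>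
  compensates the drift.\<close>

lemma shifted_orbit_convergent:
  fixes T :: "'a::{real_inner, heine_borel} \<Rightarrow> 'a" and v :: 'a
  assumes fin: "finite_dimensional TYPE('a)"
    and av: "averaged T"
    and v: "v = closest_point (closure (range (\<lambda>x. x - T x))) 0"
    and ne: "{x. x = v + T x} \<noteq> {}"
    and codim: "codim {x. x = v + T x} \<le> 1"
  shows "convergent (\<lambda>n. (T ^^ n) x + real n *\<^sub>R v)"
proof -
  define F where "F = {x. x = v + T x}"
  obtain c where c: "c > 0"
    "\<And>x y. (norm (T x - T y))\<^sup>2 \<le> (norm (x - y))\<^sup>2 - c * (norm ((x - T x) - (y - T y)))\<^sup>2"
    using averaged_strict_contraction[OF av] by blast
  have min: "norm v \<le> norm (y - T y)" for y
    using closest_point_le[of "closure (range (\<lambda>x. x - T x))" "y - T y" 0]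
    by (simp add: v closure_subset[THEN subsetD])
  \<comment> \<open>Applying the contraction estimate to \<open>f\<close> and \<open>T f\<close>,
    the displacement at \<open>T f\<close> is no longer than \<open>v\<close>; by minimality of
    \<open>v\<close> it is no shorter, so the correction term forces it to equal
    \<open>v\<close>.\<close>
  have TF: "T f \<in> F" if "f \<in> F" for f
  proof -
    have f: "f - T f = v" using that unfolding F_def by (simp add: algebra_simps)
    have "(norm v)\<^sup>2 \<le> (norm (T f - T (T f)))\<^sup>2" by (intro power_mono min) simp
    with c(2)[of f "T f"] have "c * (norm (v - (T f - T (T f))))\<^sup>2 \<le> 0" unfolding f by linarith
    then have "v = T f - T (T f)" using c(1) by (simp add: mult_le_0_iff)
    then show ?thesis unfolding F_def by (simp add: algebra_simps)
  qed
  have orbit: "(T ^^ n) f \<in> F \<and> (T ^^ n) f = f - real n *\<^sub>R v" if "f \<in> F" for f n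
  proof (induction n)
    case (Suc n)
    then have "T ((T ^^ n) f) = (T ^^ n) f - v" unfolding F_def by (simp add: algebra_simps)
    with Suc have "T ((T ^^ n) f) = f - real (Suc n) *\<^sub>R v" by (simp add: scaleR_left_distrib)
    moreover have "T ((T ^^ n) f) \<in> F" using Suc TF by blast
    ultimately show ?case by simp
  qed (use that in simp)
  define z where "z = (\<lambda>n. (T ^^ n) x + real n *\<^sub>R v)"
  have dz: "z n - f = (T ^^ n) x - (T ^^ n) f" if "f \<in> F" for f n
    using orbit[OF that, of n] by (simp add: z_def algebra_simps)
  have fejer: "(norm (z (Suc n) - f))\<^sup>2 \<le> (norm (z n - f))\<^sup>2 - c * (norm (z n - z (Suc n)))\<^sup>2"
    if f: "f \<in> F" for f n
  proof -
    \<comment> \<open>A step of \<open>z\<close> is the difference of the displacements of the two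
      orbits, exactly the quantity in the correction term of \<open>c\<close>.\<close>
    have "z n - z (Suc n) = (z n - f) - (z (Suc n) - f)" by simp
    also have "\<dots> = ((T ^^ n) x - T ((T ^^ n) x)) - ((T ^^ n) f - T ((T ^^ n) f))"
      unfolding dz[OF f] by (simp add: algebra_simps)
    finally show ?thesis using c(2)[of "(T ^^ n) x" "(T ^^ n) f"] dz[OF f, of n] dz[OF f, of "Suc n"]
      by simp
  qed
  have dec: "decseq (\<lambda>n. (norm (z n - f))\<^sup>2)" if "f \<in> F" for f
    using fejer[OF that] c(1) by (intro decseq_SucI) (smt (verit) mult_nonneg_nonneg zero_le_power2)
  obtain f0 where f0: "f0 \<in> F" using ne unfolding F_def by blast
  have bdd: "bounded (range z)"
  proof -
    have "dist f0 (z n) \<le> norm (z 0 - f0)" for n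
      using decseqD[OF dec[OF f0], of 0 n] by (simp add: dist_norm norm_minus_commute power2_le_iff_abs_le)
    then show ?thesis unfolding bounded_def by blast
  qed
  have step: "(\<lambda>n. dist (z n) (z (Suc n))) \<longlonglongrightarrow> 0"
  proof -
    \<comment> \<open>The squared step is at most the drop of the squared distance to
      \<open>f0\<close>, divided by \<open>c\<close>.\<close>
    have "(\<lambda>n. ((norm (z n - f0))\<^sup>2 - (norm (z (Suc n) - f0))\<^sup>2) / c) \<longlonglongrightarrow> 0"
      using tendsto_divide[OF decreasing_nonneg_diff_tendsto_0[OF dec[OF f0]] tendsto_const[of c]] c(1)
      by simp
    then have "(\<lambda>n. (norm (z n - z (Suc n)))\<^sup>2) \<longlonglongrightarrow> 0"
      by (rule Lim_null_comparison[rotated], intro always_eventually allI)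
        (use fejer[OF f0] c(1) in \<open>simp add: pos_le_divide_eq algebra_simps\<close>)
    then have "(\<lambda>n. sqrt ((norm (z n - z (Suc n)))\<^sup>2)) \<longlonglongrightarrow> sqrt 0"
      by (rule tendsto_real_sqrt)
    then show ?thesis by (simp add: dist_norm)
  qed
  have same_dist: "(norm (l - f))\<^sup>2 = (norm (l' - f))\<^sup>2"
    if cl: "strict_mono r" "(z \<circ> r) \<longlonglongrightarrow> l" "strict_mono r'" "(z \<circ> r') \<longlonglongrightarrow> l'"
      and f: "f \<in> F" for l l' r r' f
  proof -
    \<comment> \<open>The limit \<open>L\<close> depends only on \<open>f\<close>, not on the
      subsequence.\<close>
    obtain L where L: "(\<lambda>n. (norm (z n - f))\<^sup>2) \<longlonglongrightarrow> L"
      using decseq_convergent[OF dec[OF f], of 0] by auto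
    have "(norm (m - f))\<^sup>2 = L" if "strict_mono s" "(z \<circ> s) \<longlonglongrightarrow> m" for m s
    proof -
      have "(\<lambda>n. (norm ((z \<circ> s) n - f))\<^sup>2) \<longlonglongrightarrow> (norm (m - f))\<^sup>2"
        by (intro tendsto_intros that)
      moreover have "(\<lambda>n. (norm ((z \<circ> s) n - f))\<^sup>2) \<longlonglongrightarrow> L"
        using LIMSEQ_subseq_LIMSEQ[OF L that(1)] by (simp add: comp_def)
      ultimately show ?thesis by (rule LIMSEQ_unique)
    qed
    then show ?thesis using cl by metis
  qed
  have normal: "(l - l') \<bullet> (f - f') = 0"
    if "strict_mono r" "(z \<circ> r) \<longlonglongrightarrow> l" "strict_mono r'" "(z \<circ> r') \<longlonglongrightarrow> l'" "f \<in> F" "f' \<in> F"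
    for l l' r r' f f'
    \<comment> \<open>Subtracting the equalities for \<open>f\<close> and \<open>f'\<close> cancels
      all squared norms.\<close>
    using same_dist[OF that(1-5)] same_dist[OF that(1-4) that(6)]
    by (simp add: power2_norm_eq_inner inner_diff_left inner_diff_right inner_commute)
  obtain p r where p: "strict_mono r" "(z \<circ> r) \<longlonglongrightarrow> p"
    using bounded_imp_convergent_subsequence[OF bdd] by blast
  have "convergent z"
  proof (cases "\<exists>q s. strict_mono s \<and> (z \<circ> s) \<longlonglongrightarrow> q \<and> q \<noteq> p")
    case False
    then show ?thesis by (intro convergent_if_two_cluster_points[OF bdd step, of p p]) blast
  next
    case True
    then obtain q s where q: "strict_mono s" "(z \<circ> s) \<longlonglongrightarrow> q" "q \<noteq> p" by blast
    show ?thesis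
    proof (rule convergent_if_two_cluster_points[OF bdd step, of p q])
      fix l t assume l: "strict_mono t" "(z \<circ> t) \<longlonglongrightarrow> l"
      obtain k where k: "l - p = k *\<^sub>R (q - p)"
        using codim_le_1_normals_parallel[OF fin codim, of "q - p" "l - p"]
          normal[OF q(1,2) p] normal[OF l p] q(3) unfolding F_def by auto
      \<comment> \<open>Centred at \<open>f0\<close>, the points \<open>p\<close>, \<open>q\<close>,
        \<open>l\<close> are \<open>g\<close>, \<open>g + d\<close>,
        \<open>g + k *\<^sub>R d\<close>, all of equal norm. Eliminating
        \<open>g \<bullet> d\<close> leaves only \<open>k = 0\<close> and
        \<open>k = 1\<close>.\<close>
      define d where "d = q - p"
      define g where "g = p - f0"
      have gd: "g + d = q - f0" "g + k *\<^sub>R d = l - f0"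
        by (simp_all add: g_def d_def flip: k)
      have "(norm (g + d))\<^sup>2 = (norm g)\<^sup>2" "(norm (g + k *\<^sub>R d))\<^sup>2 = (norm g)\<^sup>2"
        unfolding gd unfolding g_def
        using same_dist[OF q(1,2) p f0] same_dist[OF l p f0] by simp_all
      then have "2 * (g \<bullet> d) + d \<bullet> d = 0" "2 * k * (g \<bullet> d) + k * k * (d \<bullet> d) = 0"
        by (simp_all add: power2_norm_eq_inner inner_add_left inner_add_right inner_commute
            algebra_simps)
      then have "k * (k - 1) * (d \<bullet> d) = 0" by algebra
      then have "k = 0 \<or> k = 1" using q(3) by (simp add: d_def)
      then show "l = p \<or> l = q" using k by auto
    qed
  qed
  then show ?thesis by (simp add: z_def)
qed

theorem theorem3p11:
  fixes T :: "'a::{real_inner, heine_borel} \<Rightarrow> 'a" and v :: 'a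
  assumes "finite_dimensional TYPE('a)"
    and "averaged T"
    and "v = closest_point (closure (range (\<lambda>x. x - T x))) 0"
    and "{x. x = v + T x} \<noteq> {}"
    and "codim {x. x = v + T x} \<le> 1"
  shows "\<forall>x y. convergent (\<lambda>n. (T ^^ n) x - (T ^^ n) y)"
proof (intro allI)
  fix x y
  \<comment> \<open>The shifts \<open>real n *\<^sub>R v\<close> cancel in the difference.\<close>
  show "convergent (\<lambda>n. (T ^^ n) x - (T ^^ n) y)"
    using convergent_diff[OF shifted_orbit_convergent[OF assms, of x]
        shifted_orbit_convergent[OF assms, of y]] by simp
qed

end
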